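(* Consider the system and observer described in the context, and suppose $x_0\in\mathcal{X}_0=\langle p_0,M_{x,0}\rangle$ and $\hat{x}_0=p_0$. Fix an integer $q>n_x$. Define recursively, for $k\ge1$, with $\mathcal{X}_{k-1}=\langle\hat{x}_{k-1},M_{x,k-1}\rangle$: $$[A]_{k-1}=\frac{\partial f}{\partial x}(\mathcal{X}_{k-1}),\qquad [Ja]_{k-1}=[A]_{k-1}M_{x,k-1},\qquad T_{k-1}=\left[D^c_{[Ja]_{k-1}}\ \ D^s_{[Ja]_{k-1}}\right],$$ $$\widetilde{M}_{x,k}=\left[(A-LC)M_{x,k-1}\ \ T_{k-1}\ \ D_1M_w\ \ LD_2M_v\right],\qquad M_{x,k}=\,\downarrow_q(\widetilde{M}_{x,k}).$$ Then for all $k\ge1$ the actual state satisfies $x_k\in\langle\hat{x}_k,\widetilde{M}_{x,k}\rangle$ and $x_k\in\mathcal{X}_k=\langle\hat{x}_k,M_{x,k}\rangle$, and $\underline{x}^z_k\le x_k\le\overline{x}^z_k$, where for $i=1,\dots,n_x$ $$\underline{x}^z_k(i)=\hat{x}_k(i)-\|\widetilde{M}_{x,k}(i,:)\|_1,\qquad \overline{x}^z_k(i)=\hat{x}_k(i)+\|\widetilde{M}_{x,k}(i,:)\|_1.$$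
   Context: Notation: inequalities and absolute values of vectors and matrices are elementwise; $M(i,:)$ is the $i$-th row of $M$ and $\|\cdot\|_1$ the sum of absolute values of entries; $z(i)$ is the $i$-th entry of $z$; $\mathrm{diag}(z)$ is the diagonal matrix with diagonal $z$. For $p\in\mathbb{R}^n$, $M\in\mathbb{R}^{n\times m}$, the zonotope $\langle p,M\rangle$ is $\{p+M\xi:\xi\in[-1,1]^m\}$. An interval matrix $[M]=[\underline{M},\overline{M}]$ is the set of matrices $M$ with $\underline{M}\le M\le\overline{M}$ elementwise. System: for $k\ge0$, $x_{k+1}=Ax_k+Bu_k+f(x_k)+D_1w_k$, $y_k=Cx_k+D_2v_k$, with $x_k\in\mathbb{R}^{n_x}$, $y_k\in\mathbb{R}^{n_y}$, $u_k\in\mathbb{R}^{n_u}$, $w_k\in\mathbb{R}^{n_w}$, $v_k\in\mathbb{R}^{n_v}$, known real matrices $A,B,C,D_1,D_2$ of suitable sizes, and differentiable $f:\mathbb{R}^{n_x}\to\mathbb{R}^{n_x}$. Standing assumption: on the feasible domain $\mathcal{X}\subseteq\mathbb{R}^{n_x}$ of the state, $\underline{J}\le\frac{\partial f}{\partial x}(x)\le\overline{J}$ for known matrices $\underline{J},\overline{J}$. Standing assumption: $|w_k|\le\overline{w}$, $|v_k|\le\overline{v}$ for all $k\ge0$ and $|x_0-p_0|\le\overline{x}_0$ with known $\overline{w},\overline{v},\overline{x}_0,p_0$; equivalently $w_k\in\langle0,M_w\rangle$, $v_k\in\langle0,M_v\rangle$, $x_0\in\langle p_0,M_{x,0}\rangle$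 with $M_w=\mathrm{diag}(\overline{w})$, $M_v=\mathrm{diag}(\overline{v})$, $M_{x,0}=\mathrm{diag}(\overline{x}_0)$. Observer: $\hat{x}_{k+1}=A\hat{x}_k+Bu_k+f(\hat{x}_k)+L(y_k-C\hat{x}_k)$ with gain $L\in\mathbb{R}^{n_x\times n_y}$. The interval matrix $[A]_{k-1}=\frac{\partial f}{\partial x}(\mathcal{X}_{k-1})$ is obtained by replacing $\mathcal{X}_{k-1}$ by its interval outer approximation and evaluating the Jacobian with interval arithmetic; thus it is an interval matrix (with finite bounds) containing $\frac{\partial f}{\partial x}(x)$ for every $x$ in the smallest axis-aligned box containing $\mathcal{X}_{k-1}$. The product $[A]_{k-1}M_{x,k-1}$ of an interval matrix and a real matrix is the interval matrix computed by interval arithmetic, with $(i,j)$ entry $\sum_l[A]_{k-1}(i,l)\,M_{x,k-1}(l,j)$. For an interval matrix $[M]=[\underline{M},\overline{M}]\subseteq\mathbb{R}^{n\times m}$: $D^c_{[M]}=\frac{\underline{M}+\overline{M}}{2}\in\mathbb{R}^{n\times m}$, $R^c_{[M]}=\frac{\overline{M}-\underline{M}}{2}$, $s_{[M]}(i)=\|R^c_{[M]}(i,:)\|_1$ for $i=1,\dots,n$, and $D^s_{[M]}=\mathrm{diag}(s_{[M]})\in\mathbb{R}^{n\times n}$. Reduction operator: for $M\in\mathbb{R}^{n\times m}$ and $n<q<m$, let $\overrightarrow{M}$ be $M$ with its columns sorted in descending order of Euclidean norm; $\downarrow_q(M)=[M^1\ M^2]$, where $M^1$ is the first $q-n$ columns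 of $\overrightarrow{M}$ and $M^2$ is the $n\times n$ diagonal matrix with $M^2(i,i)=\sum_{j=q-n+1}^m|\overrightarrow{M}(i,j)|$. If $m\le q$, $\downarrow_q(M)=M$. *)

theory Defs
  imports "HOL-Analysis.Analysis" "HOL-Library.Interval"
begin

text \<open>
  The number of columns of a generator matrix changes with time, so a generator matrix with rows
  indexed by \<open>'n\<close> is the list of its columns and \<open>@\<close> is horizontal concatenation.  Matrices of
  fixed size have a type of the form \<open>real^'m^'n\<close>; the class \<open>linorder\<close> on an index type only
  serves to list their columns in index order.
\<close>

type_synonym 'n rvec = "(real, 'n) vec"
type_synonym ('n, 'm) rmat = "((real, 'm) vec, 'n) vec" \<comment> \<open>rows \<open>'n\<close>, columns \<open>'m\<close>\<close>
type_synonym ('n, 'm) imat = "((real interval, 'm) vec, 'n) vec"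
type_synonym 'n gens = "(real, 'n) vec list"

definition columns_of :: "('n::finite, 'm::{finite,linorder}) rmat \<Rightarrow> 'n gens" where
  "columns_of M = map (\<lambda>j. column j M) (sorted_list_of_set UNIV)"

definition diag_matrix :: "real^'n \<Rightarrow> ('n, 'n) rmat" where
  "diag_matrix z = (\<chi> i j. if i = j then z $ i else 0)"

definition row_norm1 :: "'n::finite gens \<Rightarrow> 'n \<Rightarrow> real" where
  "row_norm1 M i = (\<Sum>c\<leftarrow>M. \<bar>c $ i\<bar>)"

definition zonotope :: "real^'n \<Rightarrow> 'n::finite gens \<Rightarrow> (real^'n) set" where
  "zonotope p M =
     {p + (\<Sum>j<length M. \<xi> j *\<^sub>R M ! j) | \<xi>. \<forall>j<length M. \<xi> j \<in> {-1..1}}"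

definition box_hull :: "(real^'n) set \<Rightarrow> (real^'n) set" where
  "box_hull S = (\<lambda>B. \<exists>a b. B = cbox a b) hull S"

text \<open>
  An interval evaluation of the Jacobian of \<open>f\<close> on \<open>S\<close>: any interval matrix enclosing all values of
  the Jacobian on the smallest axis-aligned box around \<open>S\<close>.  Its entries have type
  \<open>real interval\<close>, hence finite bounds.
\<close>

definition jacobian_enclosure ::
    "(real^'n \<Rightarrow> real^'m) \<Rightarrow> (real^'n) set \<Rightarrow> ('m, 'n) imat \<Rightarrow> bool" where
  "jacobian_enclosure f S IA \<longleftrightarrow>
     (\<forall>x\<in>box_hull S. \<forall>i j. jacobian f (at x) $ i $ j \<in> set_of (IA $ i $ j))"

text \<open>Interval matrices with a variable number of columns are column lists as well.\<close>

type_synonym 'n igens = "(real interval, 'n) vec list"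

definition imat_mult :: "('m::finite, 'n::finite) imat \<Rightarrow> 'n gens \<Rightarrow> 'm igens" where
  "imat_mult IA M = map (\<lambda>c. \<chi> i. \<Sum>l\<in>UNIV. IA $ i $ l * interval_of (c $ l)) M"

definition center :: "'n::finite igens \<Rightarrow> 'n gens" where
  "center IM = map (\<lambda>c. \<chi> i. (lower (c $ i) + upper (c $ i)) / 2) IM"

definition radius :: "'n::finite igens \<Rightarrow> 'n gens" where
  "radius IM = map (\<lambda>c. \<chi> i. (upper (c $ i) - lower (c $ i)) / 2) IM"

definition radius_diag :: "'n::{finite,linorder} igens \<Rightarrow> 'n gens" where
  "radius_diag IM = columns_of (diag_matrix (\<chi> i. row_norm1 (radius IM) i))"

text \<open>
  A rule for sorting columns by descending Euclidean norm.  How it orders columns of equal norm is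
  left open, so the reduction operator takes the rule as a parameter.
\<close>

definition sorts_columns :: "('n::finite gens \<Rightarrow> 'n gens) \<Rightarrow> bool" where
  "sorts_columns srt \<longleftrightarrow>
     (\<forall>M. mset (srt M) = mset M \<and> sorted_wrt (\<lambda>a b. norm a \<ge> norm b) (srt M))"

text \<open>Meaningful for \<open>q > CARD('n)\<close> only.\<close>

definition reduce ::
    "('n::{finite,linorder} gens \<Rightarrow> 'n gens) \<Rightarrow> nat \<Rightarrow> 'n gens \<Rightarrow> 'n gens" where
  "reduce srt q M =
     (if length M \<le> q then M
      else take (q - CARD('n)) (srt M) @
           columns_of (diag_matrix (\<chi> i. row_norm1 (drop (q - CARD('n)) (srt M)) i)))"

end

theory Submission
  imports Defs
begin

text \<open>
  The estimation error \<open>e\<^sub>k = x\<^sub>k - xh\<^sub>k\<close> obeys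
  \<open>e\<^sub>k\<^sub>+\<^sub>1 = (A - L C) e\<^sub>k + (f(x\<^sub>k) - f(xh\<^sub>k)) + D\<^sub>1 w\<^sub>k - L D\<^sub>2 v\<^sub>k\<close>, since the known input and the
  part of the measurement explained by the observer cancel.  Zonotopes centred at \<open>0\<close> are closed
  under linear images (\<open>matrix_image_in_zonotope\<close>), and their Minkowski sum is obtained by
  concatenating the generators (\<open>zonotope_append\<close>), so it suffices to enclose each of the four
  summands by its own block of generators.  For the linear term this is the image of the previous
  enclosure.  The two disturbance terms are linear images of points of a symmetric box, which is
  the zonotope of a diagonal matrix (\<open>box_subset_diag_zonotope\<close>).

  The nonlinear term is the only delicate one (\<open>nonlinear_increment_in_zonotope\<close>).  The mean value
  theorem, applied to each component of \<open>f\<close> separately, gives \<open>f(x\<^sub>k) - f(xh\<^sub>k) = N e\<^sub>k\<close>, where each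
  row of \<open>N\<close> is a row of the Jacobian at some point of the segment between the two states, the point
  depending on the row.  All these points lie in the bounding box of the zonotope, so \<open>N\<close> belongs to
  the interval matrix.  Writing \<open>e\<^sub>k = M \<xi>\<close> with coefficients \<open>\<xi>\<close> in \<open>[-1, 1]\<close>, the product \<open>N M\<close>
  deviates from the centre of the interval product by at most its radius in each entry.  Hence
  \<open>N M \<xi>\<close> deviates from \<open>centre \<xi>\<close> in row \<open>i\<close> by at most the \<open>i\<close>-th row sum of the radius, and a
  diagonal block of generators absorbs this deviation.

  The same absorption shows that order reduction only enlarges a zonotope: the discarded generators
  contribute a vector whose entries are bounded by their row sums (\<open>zonotope_subset_reduce\<close>).
  Membership in the reduced zonotope therefore propagates by induction over time, and the row sums
  of the unreduced generators give the componentwise bounds.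
\<close>

section \<open>Zonotopes as iterated Minkowski sums\<close>

lemma zonotope_Nil: "zonotope p [] = {p}"
  by (simp add: zonotope_def)

text \<open>
  Together with \<open>zonotope_Nil\<close> this is a recursive description of zonotopes along the list of
  generators; it replaces the coefficient families of the definition in inductions over generators.
\<close>
lemma zonotope_Cons:
  "z \<in> zonotope p (c # M) \<longleftrightarrow> (\<exists>t\<in>{-1..1}. z - t *\<^sub>R c \<in> zonotope p M)"
proof
  assume "z \<in> zonotope p (c # M)"
  then obtain \<xi> where z: "z = p + (\<Sum>j<length (c # M). \<xi> j *\<^sub>R (c # M) ! j)"
    and \<xi>: "\<forall>j<length (c # M). \<xi> j \<in> {-1..1}"
    unfolding zonotope_def by blast
  have "z - \<xi> 0 *\<^sub>R c = p + (\<Sum>j<length M. \<xi> (Suc j) *\<^sub>R M ! j)"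
    unfolding z by (simp add: sum.lessThan_Suc_shift del: sum.lessThan_Suc)
  moreover have "\<forall>j<length M. \<xi> (Suc j) \<in> {-1..1}" using \<xi> by auto
  ultimately have "z - \<xi> 0 *\<^sub>R c \<in> zonotope p M"
    unfolding zonotope_def by (intro CollectI exI[of _ "\<lambda>j. \<xi> (Suc j)"]) auto
  then show "\<exists>t\<in>{-1..1}. z - t *\<^sub>R c \<in> zonotope p M" using \<xi> by auto
next
  assume "\<exists>t\<in>{-1..1}. z - t *\<^sub>R c \<in> zonotope p M"
  then obtain t \<xi> where t: "t \<in> {-1..1}" and z: "z - t *\<^sub>R c = p + (\<Sum>j<length M. \<xi> j *\<^sub>R M ! j)"
    and \<xi>: "\<forall>j<length M. \<xi> j \<in> {-1..1}"
    unfolding zonotope_def by blast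
  have "z = p + (\<Sum>j<length (c # M). (case_nat t \<xi> j) *\<^sub>R (c # M) ! j)"
    using z by (simp add: sum.lessThan_Suc_shift algebra_simps del: sum.lessThan_Suc)
  moreover have "\<forall>j<length (c # M). case_nat t \<xi> j \<in> {-1..1}"
    using t \<xi> by (auto split: nat.split)
  ultimately show "z \<in> zonotope p (c # M)"
    unfolding zonotope_def by blast
qed

lemma zonotope_iff_sub_center: "z \<in> zonotope p M \<longleftrightarrow> z - p \<in> zonotope 0 M"
  by (induction M arbitrary: z) (auto simp: zonotope_Nil zonotope_Cons algebra_simps)

text \<open>
  Concatenation of generators is the Minkowski sum.  The equivalence also serves to split a
  zonotope into the contributions of two groups of generators.
\<close>
lemma zonotope_append:
  "z \<in> zonotope p (M @ N) \<longleftrightarrow> (\<exists>a\<in>zonotope p M. z - a \<in> zonotope 0 N)"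
proof (induction M arbitrary: z)
  case Nil
  show ?case using zonotope_iff_sub_center[of z p N] by (simp add: zonotope_Nil)
next
  case (Cons c M)
  show ?case
  proof
    assume "z \<in> zonotope p ((c # M) @ N)"
    then obtain t a where "t \<in> {-1..1}" "a \<in> zonotope p M" "z - t *\<^sub>R c - a \<in> zonotope 0 N"
      by (auto simp: zonotope_Cons Cons.IH)
    then show "\<exists>a\<in>zonotope p (c # M). z - a \<in> zonotope 0 N"
      by (intro bexI[of _ "a + t *\<^sub>R c"]) (auto simp: zonotope_Cons algebra_simps intro!: bexI[of _ t])
  next
    assume "\<exists>a\<in>zonotope p (c # M). z - a \<in> zonotope 0 N"
    then obtain t a where "t \<in> {-1..1}" "a - t *\<^sub>R c \<in> zonotope p M" "z - a \<in> zonotope 0 N"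
      by (auto simp: zonotope_Cons)
    then show "z \<in> zonotope p ((c # M) @ N)"
      by (auto simp: zonotope_Cons Cons.IH intro!: bexI[of _ t] bexI[of _ "a - t *\<^sub>R c"])
  qed
qed

lemma add_in_zonotope_append:
  assumes "a \<in> zonotope 0 M" "b \<in> zonotope 0 N"
  shows "a + b \<in> zonotope 0 (M @ N)"
  using assms by (auto simp: zonotope_append intro!: bexI[of _ a])

lemma center_in_zonotope: "p \<in> zonotope p M"
  by (induction M) (auto simp: zonotope_Nil zonotope_Cons intro!: bexI[of _ 0])

text \<open>
  Sums are commutative, so sorting the generators does no harm.  The first generator of one list is
  located in the other one and moved across its prefix.
\<close>
lemma zonotope_permuted:
  assumes "mset M = mset N" "z \<in> zonotope p M"
  shows "z \<in> zonotope p N"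
  using assms
proof (induction M arbitrary: N z)
  case Nil
  then show ?case by simp
next
  case (Cons c M)
  have "c \<in> set N" using Cons.prems(1) by (metis list.set_intros(1) set_mset_mset)
  then obtain N1 N2 where N: "N = N1 @ c # N2" by (meson split_list)
  obtain t where t: "t \<in> {-1..1}" and "z - t *\<^sub>R c \<in> zonotope p M"
    using Cons.prems(2) by (auto simp: zonotope_Cons)
  then have "z - t *\<^sub>R c \<in> zonotope p (N1 @ N2)"
    using Cons.IH[of "N1 @ N2"] Cons.prems(1) N by auto
  then obtain a where "a \<in> zonotope p N1" "z - t *\<^sub>R c - a \<in> zonotope 0 N2"
    by (auto simp: zonotope_append)
  with t show ?case
    unfolding N by (auto simp: zonotope_append zonotope_Cons algebra_simps intro!: bexI[of _ a] bexI[of _ t])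
qed

lemma matrix_image_in_zonotope:
  fixes A :: "real^'n^'m::finite"
  assumes "z \<in> zonotope 0 M"
  shows "A *v z \<in> zonotope 0 (map ((*v) A) M)"
  using assms
proof (induction M arbitrary: z)
  case Nil
  then show ?case by (simp add: zonotope_Nil)
next
  case (Cons c M)
  then obtain t where t: "t \<in> {-1..1}" "z - t *\<^sub>R c \<in> zonotope 0 M"
    by (auto simp: zonotope_Cons)
  have "A *v (z - t *\<^sub>R c) = A *v z - t *\<^sub>R (A *v c)"
    by (simp add: matrix_vector_mult_diff_distrib matrix_vector_mult_scaleR)
  with Cons.IH[OF t(2)] t(1) show ?case by (auto simp: zonotope_Cons)
qed

text \<open>
  Replacing each generator by a nearby one, while keeping the coefficients, moves the point by at
  most the sum of the tolerances, since the coefficients have absolute value at most \<open>1\<close>.  Each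
  element of \<open>Q\<close> pairs a new generator with its entrywise tolerance.
\<close>
lemma zonotope_perturbed_columns:
  assumes "list_all2 (\<lambda>a b. \<forall>i. \<bar>a $ i - fst b $ i\<bar> \<le> snd b $ i) P Q"
    and "z \<in> zonotope 0 P"
  shows "\<exists>z'\<in>zonotope 0 (map fst Q). \<forall>i. \<bar>z $ i - z' $ i\<bar> \<le> row_norm1 (map snd Q) i"
  using assms
proof (induction arbitrary: z rule: list_all2_induct)
  case Nil
  then show ?case by (simp add: zonotope_Nil row_norm1_def)
next
  case (Cons a P b Q)
  obtain t where t: "t \<in> {-1..1}" "z - t *\<^sub>R a \<in> zonotope 0 P"
    using Cons.prems by (auto simp: zonotope_Cons)
  then obtain z' where z': "z' \<in> zonotope 0 (map fst Q)"
    and bnd: "\<And>i. \<bar>(z - t *\<^sub>R a) $ i - z' $ i\<bar> \<le> row_norm1 (map snd Q) i"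
    using Cons.IH by blast
  show ?case
  proof (intro bexI[of _ "z' + t *\<^sub>R fst b"] allI)
    show "z' + t *\<^sub>R fst b \<in> zonotope 0 (map fst (b # Q))"
      using z' t(1) by (auto simp: zonotope_Cons intro!: bexI[of _ t])
    fix i
    have "\<bar>t\<bar> * \<bar>a $ i - fst b $ i\<bar> \<le> 1 * \<bar>snd b $ i\<bar>"
      using t(1) Cons.hyps(1) by (intro mult_mono) (auto intro: order_trans[OF _ abs_ge_self])
    then have "\<bar>t * (a $ i - fst b $ i)\<bar> \<le> \<bar>snd b $ i\<bar>" by (simp add: abs_mult)
    moreover have "z $ i - (z' + t *\<^sub>R fst b) $ i =
        ((z - t *\<^sub>R a) $ i - z' $ i) + t * (a $ i - fst b $ i)"
      by (simp add: algebra_simps)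
    ultimately show "\<bar>z $ i - (z' + t *\<^sub>R fst b) $ i\<bar> \<le> row_norm1 (map snd (b # Q)) i"
      using bnd[of i] by (simp add: row_norm1_def)
  qed
qed

section \<open>Boxes, diagonal generators and order reduction\<close>

lemma zonotope_row_bound:
  assumes "z \<in> zonotope 0 M"
  shows "\<bar>z $ i\<bar> \<le> row_norm1 M i"
  using assms
proof (induction M arbitrary: z)
  case Nil
  then show ?case by (simp add: zonotope_Nil row_norm1_def)
next
  case (Cons c M)
  then obtain t where t: "t \<in> {-1..1}" "z - t *\<^sub>R c \<in> zonotope 0 M"
    by (auto simp: zonotope_Cons)
  have "\<bar>t * c $ i\<bar> \<le> 1 * \<bar>c $ i\<bar>"
    unfolding abs_mult using t(1) by (intro mult_mono) auto
  with Cons.IH[OF t(2)] show ?case by (simp add: row_norm1_def)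
qed

lemma combination_in_zonotope:
  assumes "\<And>j. t j \<in> {-1..1}"
  shows "(\<Sum>j\<leftarrow>js. t j *\<^sub>R g j) \<in> zonotope 0 (map g js)"
proof (induction js)
  case Nil
  show ?case by (simp add: zonotope_Nil)
next
  case (Cons j js)
  then show ?case
    using assms[of j] by (auto simp: zonotope_Cons intro!: bexI[of _ "t j"])
qed

text \<open>
  The coefficient of the \<open>i\<close>-th axis is \<open>z(i) / r(i)\<close>.  If \<open>r(i) = 0\<close>, then \<open>z(i) = 0\<close> as well, and
  the value \<open>0\<close> of a division by \<open>0\<close> is the right coefficient.
\<close>
lemma box_subset_diag_zonotope:
  fixes z :: "real^'n::{finite,linorder}"
  assumes "\<And>i. \<bar>z $ i\<bar> \<le> r $ i"
  shows "z \<in> zonotope 0 (columns_of (diag_matrix r))"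
proof -
  define t where "t j = z $ j / r $ j" for j
  have t: "t j \<in> {-1..1}" for j
    using assms[of j] by (auto simp: t_def divide_simps abs_le_iff)
  have zt: "z $ i = t i * r $ i" for i
    using assms[of i] by (auto simp: t_def)
  have "(\<Sum>j\<leftarrow>sorted_list_of_set UNIV. t j *\<^sub>R column j (diag_matrix r))
      = (\<Sum>j\<in>UNIV. t j *\<^sub>R column j (diag_matrix r))"
    by (simp add: sum_list_distinct_conv_sum_set)
  also have "\<dots> = z"
    by (simp add: vec_eq_iff column_def diag_matrix_def zt if_distrib sum.delta cong: if_cong)
  finally show ?thesis
    using combination_in_zonotope[of t "\<lambda>j. column j (diag_matrix r)", OF t]
    unfolding columns_of_def by metis
qed

text \<open>
  The discarded generators span a zonotope inside the symmetric box given by their row sums, and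
  that box is exactly the diagonal block which replaces them.
\<close>
lemma zonotope_subset_reduce:
  assumes "sorts_columns srt" "z \<in> zonotope p M"
  shows "z \<in> zonotope p (reduce srt q M)"
proof (cases "length M \<le> q")
  case True
  then show ?thesis using assms(2) by (simp add: reduce_def)
next
  case False
  let ?k = "q - CARD('a)"
  have "mset M = mset (srt M)" using assms(1) by (simp add: sorts_columns_def)
  then have "z \<in> zonotope p (take ?k (srt M) @ drop ?k (srt M))"
    using zonotope_permuted[OF _ assms(2), of "srt M"] by simp
  then obtain a where a: "a \<in> zonotope p (take ?k (srt M))"
    and "z - a \<in> zonotope 0 (drop ?k (srt M))"
    by (auto simp: zonotope_append simp del: append_take_drop_id)
  then have "z - a \<in> zonotope 0
      (columns_of (diag_matrix (\<chi> i. row_norm1 (drop ?k (srt M)) i)))"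
    by (intro box_subset_diag_zonotope) (simp only: vec_lambda_beta zonotope_row_bound)
  with a show ?thesis using False by (auto simp: reduce_def zonotope_append)
qed

lemma columns_of_mult: "columns_of (A ** N) = map ((*v) A) (columns_of N)"
  by (auto simp: columns_of_def column_def vec_eq_iff matrix_matrix_mult_def matrix_vector_mult_def)

text \<open>The form in which the bounded disturbances enter the error dynamics.\<close>
lemma scaled_box_in_zonotope:
  assumes "\<bar>z\<bar> \<le> r"
  shows "A *v z \<in> zonotope 0 (columns_of (A ** diag_matrix r))"
proof -
  have "\<bar>z $ i\<bar> \<le> r $ i" for i
    using assms by (simp add: less_eq_vec_def abs_vec_def)
  then show ?thesis
    unfolding columns_of_mult by (intro matrix_image_in_zonotope box_subset_diag_zonotope)
qed

section \<open>Enclosing the nonlinear increment\<close>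

lemma subset_box_hull: "S \<subseteq> box_hull S"
  unfolding box_hull_def by (rule hull_subset)

lemma convex_box_hull: "convex (box_hull S)"
  unfolding box_hull_def hull_def by (intro convex_Inter) auto

text \<open>
  There is no mean value theorem with equality for vector-valued maps, so each component of \<open>f\<close> has
  its own intermediate point.  The matrix \<open>N\<close> need not be a Jacobian of \<open>f\<close>; only its rows are rows
  of Jacobians, which is all that an entrywise enclosure sees.
\<close>
lemma mean_value_rowwise:
  fixes f :: "real^'n \<Rightarrow> real^'m"
  assumes diff: "\<And>z. f differentiable (at z)"
    and S: "convex S" "a \<in> S" "b \<in> S"
  shows "\<exists>N. f b - f a = N *v (b - a) \<and> (\<forall>i. \<exists>z\<in>S. N $ i = jacobian f (at z) $ i)"
proof -
  have "\<exists>z\<in>S. (f b - f a) $ i = (jacobian f (at z) *v (b - a)) $ i" for i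
  proof -
    let ?l = "\<lambda>t::real. a + t *\<^sub>R (b - a)"
    have "((\<lambda>t. f (?l t) $ i) has_derivative
        (\<lambda>h. (jacobian f (at (?l t)) *v (h *\<^sub>R (b - a))) $ i)) (at t within {0..1})" for t
    proof -
      have f: "(f has_derivative (\<lambda>h. jacobian f (at (?l t)) *v h)) (at (?l t))"
        using diff jacobian_works by blast
      have l: "(?l has_derivative (\<lambda>h. h *\<^sub>R (b - a))) (at t within {0..1})"
        by (auto intro!: derivative_eq_intros)
      show ?thesis
        by (rule bounded_linear.has_derivative[OF bounded_linear_vec_nth has_derivative_compose[OF l f]])
    qed
    from mvt_very_simple[OF zero_le_one this]
    obtain t where t: "t \<in> {0..1}"
      "f (?l 1) $ i - f (?l 0) $ i = (jacobian f (at (?l t)) *v ((1 - 0) *\<^sub>R (b - a))) $ i"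
      by blast
    have "?l t = (1 - t) *\<^sub>R a + t *\<^sub>R b" by (simp add: algebra_simps)
    then have "?l t \<in> S" using S t(1) by (simp add: convex_alt)
    with t(2) show ?thesis by auto
  qed
  then obtain \<zeta> where \<zeta>: "\<And>i. \<zeta> i \<in> S"
    "\<And>i. (f b - f a) $ i = (jacobian f (at (\<zeta> i)) *v (b - a)) $ i" by metis
  show ?thesis
    using \<zeta> by (intro exI[of _ "\<chi> i. jacobian f (at (\<zeta> i)) $ i"])
      (auto simp: vec_eq_iff matrix_vector_mult_def)
qed

lemma imat_mult_sound:
  fixes N :: "real^'n^'m"
  assumes "\<And>i l. N $ i $ l \<in> set_of (IA $ i $ l)"
  shows "(N *v c) $ i \<in> set_of (\<Sum>l\<in>UNIV. IA $ i $ l * interval_of (c $ l))"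
proof -
  have "(\<Sum>l\<in>S. N $ i $ l * c $ l) \<in> set_of (\<Sum>l\<in>S. IA $ i $ l * interval_of (c $ l))" for S
  proof (induction S rule: infinite_finite_induct)
    case (insert l S)
    then show ?case
      using assms by (auto intro!: plus_in_intervalI times_in_intervalI)
  qed (auto simp: set_of_eq)
  then show ?thesis by (simp add: matrix_vector_mult_def)
qed

text \<open>
  The centre of the interval product approximates \<open>N M\<close> up to the radius, entry by entry.  The
  resulting error of \<open>N e\<close> lies in the box of the row sums of the radius, which is the zonotope of
  \<open>radius_diag\<close>.
\<close>
lemma interval_product_in_zonotope:
  assumes N: "\<And>i l. N $ i $ l \<in> set_of (IA $ i $ l)"
    and e: "e \<in> zonotope 0 M"
  shows "N *v e \<in> zonotope 0 (center (imat_mult IA M) @ radius_diag (imat_mult IA M))"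
proof -
  let ?I = "\<lambda>c. \<chi> i. \<Sum>l\<in>UNIV. IA $ i $ l * interval_of (c $ l)"
  let ?g = "\<lambda>c. (\<chi> i. (lower (?I c $ i) + upper (?I c $ i)) / 2,
                 \<chi> i. (upper (?I c $ i) - lower (?I c $ i)) / 2)"
  \<comment> \<open>\<open>?g c\<close> pairs the centre of the column of the interval product that \<open>c\<close> yields with its radius.\<close>
  have near: "\<bar>(N *v c) $ i - fst (?g c) $ i\<bar> \<le> snd (?g c) $ i" for c i
    using imat_mult_sound[OF N, of c i] by (auto simp: set_of_eq abs_le_iff field_simps)
  have "list_all2 (\<lambda>a b. \<forall>i. \<bar>a $ i - fst b $ i\<bar> \<le> snd b $ i) (map ((*v) N) M) (map ?g M)"
    using near by (simp add: list_all2_conv_all_nth)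
  from zonotope_perturbed_columns[OF this matrix_image_in_zonotope[OF e]]
  obtain z where z: "z \<in> zonotope 0 (center (imat_mult IA M))"
    "\<And>i. \<bar>(N *v e) $ i - z $ i\<bar> \<le> row_norm1 (radius (imat_mult IA M)) i"
    by (auto simp: center_def radius_def imat_mult_def comp_def)
  then have "N *v e - z \<in> zonotope 0 (radius_diag (imat_mult IA M))"
    unfolding radius_diag_def by (intro box_subset_diag_zonotope) simp
  with z(1) show ?thesis by (auto simp: zonotope_append)
qed

text \<open>
  A point and the centre of a zonotope both lie in its bounding box, which is convex and hence
  contains the intermediate points of the mean value theorem.
\<close>
lemma nonlinear_increment_in_zonotope:
  assumes "\<And>z. f differentiable (at z)"
    and "jacobian_enclosure f (zonotope p M) IA"
    and "x \<in> zonotope p M"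
  shows "f x - f p \<in> zonotope 0 (center (imat_mult IA M) @ radius_diag (imat_mult IA M))"
proof -
  let ?S = "box_hull (zonotope p M)"
  have "p \<in> ?S" "x \<in> ?S"
    using subset_box_hull center_in_zonotope assms(3) by blast+
  from mean_value_rowwise[of f, OF assms(1) convex_box_hull this]
  obtain N where N: "f x - f p = N *v (x - p)"
    "\<And>i. \<exists>z\<in>?S. N $ i = jacobian f (at z) $ i" by blast
  have "N $ i $ l \<in> set_of (IA $ i $ l)" for i l
    using N(2)[of i] assms(2) unfolding jacobian_enclosure_def by metis
  moreover have "x - p \<in> zonotope 0 M" using assms(3) zonotope_iff_sub_center by blast
  ultimately show ?thesis unfolding N(1) by (rule interval_product_in_zonotope)
qed

theorem theorem2:
  fixes A :: "('nx::{finite,linorder}, 'nx) rmat"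
    and B :: "('nx, 'nu::finite) rmat"
    and C :: "('ny::finite, 'nx) rmat"
    and D\<^sub>1 :: "('nx, 'nw::{finite,linorder}) rmat"
    and D\<^sub>2 :: "('ny, 'nv::{finite,linorder}) rmat"
    and L :: "('nx, 'ny) rmat"
    and f :: "'nx rvec \<Rightarrow> 'nx rvec"
    and \<X> :: "'nx rvec set"
    and J_lo J_up :: "('nx, 'nx) rmat"
    and x xh :: "nat \<Rightarrow> 'nx rvec"
    and y :: "nat \<Rightarrow> 'ny rvec"
    and u :: "nat \<Rightarrow> 'nu rvec"
    and w :: "nat \<Rightarrow> 'nw rvec"
    and v :: "nat \<Rightarrow> 'nv rvec"
    and w_bar :: "'nw rvec" and v_bar :: "'nv rvec" and x0_bar p0 :: "'nx rvec"
    and q :: nat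
    and srt :: "'nx gens \<Rightarrow> 'nx gens"
    and IA :: "nat \<Rightarrow> ('nx, 'nx) imat"
    and IJa :: "nat \<Rightarrow> 'nx igens"
    and T Mt M :: "nat \<Rightarrow> 'nx gens"
  assumes f_diff: "\<And>z. f differentiable (at z)"
    and f_jacobian: "\<And>z. z \<in> \<X> \<Longrightarrow> J_lo \<le> jacobian f (at z) \<and> jacobian f (at z) \<le> J_up"
    and state: "\<And>k. x (Suc k) = A *v x k + B *v u k + f (x k) + D\<^sub>1 *v w k"
    and meas: "\<And>k. y k = C *v x k + D\<^sub>2 *v v k"
    and w_bound: "\<And>k. \<bar>w k\<bar> \<le> w_bar"
    and v_bound: "\<And>k. \<bar>v k\<bar> \<le> v_bar"
    and x0_bound: "\<bar>x 0 - p0\<bar> \<le> x0_bar"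
    and observer: "\<And>k. xh (Suc k) = A *v xh k + B *v u k + f (xh k) + L *v (y k - C *v xh k)"
    and M_0: "M 0 = columns_of (diag_matrix x0_bar)"
    and x0_in: "x 0 \<in> zonotope p0 (M 0)"
    and xh_0: "xh 0 = p0"
    and q: "q > CARD('nx)"
    and srt: "sorts_columns srt"
    and IA: "\<And>k. k \<ge> 1 \<Longrightarrow> jacobian_enclosure f (zonotope (xh (k - 1)) (M (k - 1))) (IA (k - 1))"
    and IJa: "\<And>k. k \<ge> 1 \<Longrightarrow> IJa (k - 1) = imat_mult (IA (k - 1)) (M (k - 1))"
    and T: "\<And>k. k \<ge> 1 \<Longrightarrow> T (k - 1) = center (IJa (k - 1)) @ radius_diag (IJa (k - 1))"
    and Mt: "\<And>k. k \<ge> 1 \<Longrightarrow>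
        Mt k = map ((*v) (A - L ** C)) (M (k - 1)) @ T (k - 1)
          @ columns_of (D\<^sub>1 ** diag_matrix w_bar)
          @ columns_of (L ** D\<^sub>2 ** diag_matrix v_bar)"
    and M: "\<And>k. k \<ge> 1 \<Longrightarrow> M k = reduce srt q (Mt k)"
  shows "\<forall>k\<ge>1. x k \<in> zonotope (xh k) (Mt k) \<and> x k \<in> zonotope (xh k) (M k) \<and>
           (\<chi> i. xh k $ i - row_norm1 (Mt k) i) \<le> x k \<and>
           x k \<le> (\<chi> i. xh k $ i + row_norm1 (Mt k) i)"
proof -
  have step: "x (Suc k) \<in> zonotope (xh (Suc k)) (Mt (Suc k))"
    if xk: "x k \<in> zonotope (xh k) (M k)" for k
  proof -
    let ?e = "x k - xh k"
    have "?e \<in> zonotope 0 (M k)" using xk zonotope_iff_sub_center by blast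
    then have lin: "(A - L ** C) *v ?e \<in> zonotope 0 (map ((*v) (A - L ** C)) (M k))"
      by (rule matrix_image_in_zonotope)
    have nonlin: "f (x k) - f (xh k) \<in> zonotope 0 (T k)"
      using nonlinear_increment_in_zonotope[OF f_diff _ xk] IA[of "Suc k"] IJa[of "Suc k"]
        T[of "Suc k"] by simp
    have dist: "D\<^sub>1 *v w k \<in> zonotope 0 (columns_of (D\<^sub>1 ** diag_matrix w_bar))"
      by (rule scaled_box_in_zonotope[OF w_bound])
    \<comment> \<open>The noise enters with a negative sign, but its box is symmetric.\<close>
    have "\<bar>- v k\<bar> \<le> v_bar" using v_bound[of k] by simp
    then have noise: "(L ** D\<^sub>2) *v (- v k) \<in> zonotope 0 (columns_of (L ** D\<^sub>2 ** diag_matrix v_bar))"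
      by (rule scaled_box_in_zonotope)
    have "x (Suc k) - xh (Suc k) = (A - L ** C) *v ?e +
        ((f (x k) - f (xh k)) + (D\<^sub>1 *v w k + (L ** D\<^sub>2) *v (- v k)))"
      unfolding state observer meas
      by (simp add: matrix_vector_mult_diff_distrib matrix_vector_mult_diff_rdistrib
          matrix_vector_right_distrib matrix_vector_mul_assoc[symmetric]
          linear_neg[OF matrix_vector_mul_linear] algebra_simps)
    also have "\<dots> \<in> zonotope 0 (Mt (Suc k))"
      using add_in_zonotope_append[OF lin add_in_zonotope_append[OF nonlin
            add_in_zonotope_append[OF dist noise]]] Mt[of "Suc k"] by simp
    finally show ?thesis using zonotope_iff_sub_center by blast
  qed
  have reduced: "x k \<in> zonotope (xh k) (M k)" for k
  proof (induction k)
    case 0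
    show ?case using x0_in xh_0 by simp
  next
    case (Suc k)
    show ?case
      using zonotope_subset_reduce[OF srt step[OF Suc]] M[of "Suc k"] by simp
  qed
  have unreduced: "x k \<in> zonotope (xh k) (Mt k)" if "k \<ge> 1" for k
    using step[OF reduced, of "k - 1"] that by simp
  have "(\<chi> i. xh k $ i - row_norm1 (Mt k) i) \<le> x k \<and>
      x k \<le> (\<chi> i. xh k $ i + row_norm1 (Mt k) i)" if "k \<ge> 1" for k
  proof -
    have "x k - xh k \<in> zonotope 0 (Mt k)"
      using unreduced[OF that] zonotope_iff_sub_center by blast
    then have "\<bar>x k $ i - xh k $ i\<bar> \<le> row_norm1 (Mt k) i" for i
      using zonotope_row_bound[of "x k - xh k" "Mt k" i] by simp
    then show ?thesis by (auto simp: less_eq_vec_def abs_le_iff algebra_simps)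
  qed
  then show ?thesis using unreduced reduced by blast
qed

end
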